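(* Every finite Coxeter group is superfuturistic.
   Context: Let $(W,S)$ be a Coxeter system with $S=\{s_i:i\in I\}$, $I$ a finite index set; $m(i,i')$ is the order of $s_is_{i'}$. The root space is $V=\mathbb R^I$ with standard basis the simple roots $\{\alpha_i:i\in I\}$ and symmetric bilinear form $B(\alpha_i,\alpha_{i'})=-\cos(\pi/m(i,i'))$ (and $-1$ if $m(i,i')=\infty$). $W$ acts on $V$ by $s_i\beta=\beta-2B(\beta,\alpha_i)\alpha_i$. The root system is $\Phi=\{w\alpha_i:w\in W,i\in I\}=\Phi^+\sqcup\Phi^-$, where $\Phi^+$ are the roots that are nonnegative combinations of simple roots and $\Phi^-=-\Phi^+$. For $\beta\in\Phi$ the half-space $H_\beta^+$ is $\{w\in W:w\beta\in\Phi^+\}$. A subset of $W$ is convex if it is an intersection of half-spaces (the empty intersection being $W$). For a nonempty convex set $\mathscr L\subseteq W$ let $\mathrm R(\mathscr L)=\{\beta\in\Phi:\mathscr L\subseteq H_\beta^+\}$. For $i\in I$, the toggle $\tau_i\colon W\to W$ is defined by $\tau_i(u)=u$ if $u^{-1}\alpha_i\in\mathrm R(\mathscr L)$ and $\tau_i(u)=s_iu$ otherwise. A Coxeter element is a product $c=s_{i_n}\cdots s_{i_1}$ where $i_1,\ldots,i_n$ is an ordering of $I$ (each element once); $\mathrm{Pro}_c=\tau_{i_n}\cdots\tau_{i_1}$ (composition), which depends only on $c$ and $\mathscr L$. The set $\mathscr L$ is superheavy with respect to $c$ if for every $u\in W$ there is an integer $K\ge 0$ with $\mathrm{Pro}_c^K(u)\in\mathscr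 L$. The Coxeter group $W$ (with its given system $(W,S)$) is superfuturistic if every nonempty convex subset of $W$ is superheavy with respect to every Coxeter element of $W$. *)

theory Defs
  imports "HOL-Analysis.Analysis" "HOL-Algebra.Algebra"
begin

text \<open>
  \<open>word_equiv m I\<close> is the congruence on words generated by the Coxeter relations
  \<open>(i j)^(m i j) = 1\<close>. The case \<open>m i j = 0\<close> (infinite order) gives the empty relation; since
  \<open>m i i = 1\<close> in a Coxeter system, letters are self-inverse and no formal inverses are needed.
\<close>

inductive word_equiv :: "('i \<Rightarrow> 'i \<Rightarrow> nat) \<Rightarrow> 'i set \<Rightarrow> 'i list \<Rightarrow> 'i list \<Rightarrow> bool"
  for m :: "'i \<Rightarrow> 'i \<Rightarrow> nat" and I :: "'i set" where
  refl: "word_equiv m I xs xs"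
| sym: "word_equiv m I xs ys \<Longrightarrow> word_equiv m I ys xs"
| trans: "word_equiv m I xs ys \<Longrightarrow> word_equiv m I ys zs \<Longrightarrow> word_equiv m I xs zs"
| relation: "i \<in> I \<Longrightarrow> j \<in> I \<Longrightarrow>
    word_equiv m I (xs @ concat (replicate (m i j) [i, j]) @ ys) (xs @ ys)"

definition word_val :: "('a, 'b) monoid_scheme \<Rightarrow> ('i \<Rightarrow> 'a) \<Rightarrow> 'i list \<Rightarrow> 'a" where
  "word_val W s xs = foldr (\<lambda>i g. s i \<otimes>\<^bsub>W\<^esub> g) xs \<one>\<^bsub>W\<^esub>"

text \<open>
  A Coxeter system: the assumptions \<open>generated\<close> and \<open>presented\<close> say that \<open>W\<close> has the presentation
  with generators \<open>s i\<close> and relations \<open>(s i s j)^(m i j) = 1\<close>, \<open>m i j\<close> being the order of \<open>s i s j\<close>.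
  The library function \<^const>\<open>group.ord\<close> is 0 on elements of infinite order.
\<close>

locale coxeter_system = group W
  for W :: "('a, 'b) monoid_scheme" (structure) +
  fixes I :: "'i set" and s :: "'i \<Rightarrow> 'a"
  assumes finite_index: "finite I"
    and gen_closed: "i \<in> I \<Longrightarrow> s i \<in> carrier W"
    and gen_inj: "inj_on s I"
    and gen_order: "i \<in> I \<Longrightarrow> ord (s i) = 2"
    and generated: "generate W (s ` I) = carrier W"
    and presented: "set xs \<subseteq> I \<Longrightarrow> word_val W s xs = \<one> \<Longrightarrow>
      word_equiv (\<lambda>i j. ord (s i \<otimes> s j)) I xs []"
begin

definition m :: "'i \<Rightarrow> 'i \<Rightarrow> nat" where
  "m i j = ord (s i \<otimes> s j)"

text \<open>Vectors of the root space are functions \<open>'i \<Rightarrow> real\<close>, read as coordinates on \<open>I\<close>.\<close>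

definition simple_root :: "'i \<Rightarrow> 'i \<Rightarrow> real" where
  "simple_root i = (\<lambda>j. if j = i then 1 else 0)"

definition form_coeff :: "'i \<Rightarrow> 'i \<Rightarrow> real" where
  "form_coeff i j = (if m i j = 0 then -1 else - cos (pi / real (m i j)))"

definition B :: "('i \<Rightarrow> real) \<Rightarrow> ('i \<Rightarrow> real) \<Rightarrow> real" where
  "B \<beta> \<gamma> = (\<Sum>i\<in>I. \<Sum>j\<in>I. \<beta> i * \<gamma> j * form_coeff i j)"

definition reflection :: "'i \<Rightarrow> ('i \<Rightarrow> real) \<Rightarrow> 'i \<Rightarrow> real" where
  "reflection i \<beta> = (\<lambda>j. \<beta> j - 2 * B \<beta> (simple_root i) * simple_root i j)"

text \<open>
  The action of \<open>W\<close> on the root space extending \<open>s i \<mapsto> reflection i\<close>; the lemmas \<open>act_word\<close>,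
  \<open>act_gen\<close> and \<open>act_mult\<close> below show that the description is proper.
\<close>

definition act :: "'a \<Rightarrow> ('i \<Rightarrow> real) \<Rightarrow> 'i \<Rightarrow> real" where
  "act w = (THE f. \<exists>xs. set xs \<subseteq> I \<and> word_val W s xs = w \<and> f = foldr reflection xs)"

definition roots :: "('i \<Rightarrow> real) set" where
  "roots = {act w (simple_root i) | w i. w \<in> carrier W \<and> i \<in> I}"

definition pos_roots :: "('i \<Rightarrow> real) set" where
  "pos_roots = {\<beta> \<in> roots. \<exists>a. (\<forall>i\<in>I. 0 \<le> a i) \<and> \<beta> = (\<lambda>j. \<Sum>i\<in>I. a i * simple_root i j)}"

definition half_space :: "('i \<Rightarrow> real) \<Rightarrow> 'a set" where
  "half_space \<beta> = {w \<in> carrier W. act w \<beta> \<in> pos_roots}"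

definition convex_set :: "'a set \<Rightarrow> bool" where
  "convex_set L \<longleftrightarrow> (\<exists>A\<subseteq>roots. L = carrier W \<inter> (\<Inter>\<beta>\<in>A. half_space \<beta>))"

definition R :: "'a set \<Rightarrow> ('i \<Rightarrow> real) set" where
  "R L = {\<beta> \<in> roots. L \<subseteq> half_space \<beta>}"

definition toggle :: "'a set \<Rightarrow> 'i \<Rightarrow> 'a \<Rightarrow> 'a" where
  "toggle L i u = (if act (inv u) (simple_root i) \<in> R L then u else s i \<otimes> u)"

text \<open>
  An ordering \<open>i\<^sub>1, \<dots>, i\<^sub>n\<close> of \<open>I\<close> is the list \<open>[i\<^sub>1, \<dots>, i\<^sub>n]\<close>. Both the Coxeter element
  \<open>s i\<^sub>n \<dots> s i\<^sub>1\<close> and the composition of toggles have \<open>i\<^sub>1\<close> rightmost, so the toggle for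
  \<open>i\<^sub>1\<close> is applied first.
\<close>

definition is_ordering :: "'i list \<Rightarrow> bool" where
  "is_ordering ks \<longleftrightarrow> distinct ks \<and> set ks = I"

definition coxeter_elem :: "'i list \<Rightarrow> 'a" where
  "coxeter_elem ks = word_val W s (rev ks)"

definition is_coxeter_element :: "'a \<Rightarrow> bool" where
  "is_coxeter_element c \<longleftrightarrow> (\<exists>ks. is_ordering ks \<and> c = coxeter_elem ks)"

definition Pro :: "'a set \<Rightarrow> 'i list \<Rightarrow> 'a \<Rightarrow> 'a" where
  "Pro L ks = fold (toggle L) ks"

text \<open>
  \<open>Pro L ks\<close> depends only on \<open>coxeter_elem ks\<close>, not on the ordering. Quantifying over all orderings
  that represent \<open>c\<close> avoids building this fact into the definition.
\<close>

definition superheavy :: "'a set \<Rightarrow> 'a \<Rightarrow> bool" where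
  "superheavy L c \<longleftrightarrow> (\<forall>ks. is_ordering ks \<and> coxeter_elem ks = c \<longrightarrow>
     (\<forall>u\<in>carrier W. \<exists>K. (Pro L ks ^^ K) u \<in> L))"

definition superfuturistic :: bool where
  "superfuturistic \<longleftrightarrow> (\<forall>L c. L \<noteq> {} \<and> convex_set L \<and> is_coxeter_element c \<longrightarrow> superheavy L c)"

subsection \<open>The action is well defined\<close>

lemma m_self:
  assumes "i \<in> I" shows "m i i = 1"
proof -
  have "s i [^] (2::nat) = \<one>"
    using pow_ord_eq_1[OF gen_closed[OF assms]] gen_order[OF assms] by simp
  then have "s i \<otimes> s i = \<one>"
    using gen_closed[OF assms] by (simp add: numeral_2_eq_2)
  then show ?thesis by (simp add: m_def ord_eq_1)
qed

lemma gen_square: "i \<in> I \<Longrightarrow> s i \<otimes> s i = \<one>"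
  using m_self[of i] ord_eq_1[of "s i \<otimes> s i"] gen_closed by (simp add: m_def)

lemma inv_gen: "i \<in> I \<Longrightarrow> inv (s i) = s i"
  using gen_square gen_closed inv_equality by blast

lemma m_neq_one:
  assumes "i \<in> I" "j \<in> I" "i \<noteq> j" shows "m i j \<noteq> 1"
proof
  assume "m i j = 1"
  then have "s i \<otimes> s j = \<one>" using ord_eq_1 gen_closed assms by (simp add: m_def)
  then have "s i = inv (s j)" using inv_equality gen_closed assms by metis
  then show False using inv_gen assms gen_inj by (auto dest: inj_onD)
qed

lemma m_sym:
  assumes "i \<in> I" "j \<in> I" shows "m i j = m j i"
proof -
  have "inv (s i \<otimes> s j) = s j \<otimes> s i"
    using assms gen_closed inv_gen by (simp add: inv_mult_group)
  then show ?thesis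
    using ord_inv[of "s i \<otimes> s j"] assms gen_closed by (simp add: m_def)
qed

lemma B_simple:
  assumes "i \<in> I" shows "B \<beta> (simple_root i) = (\<Sum>k\<in>I. \<beta> k * form_coeff k i)"
proof -
  have "(\<Sum>j\<in>I. \<beta> k * simple_root i j * form_coeff k j) = \<beta> k * form_coeff k i" for k
    using assms finite_index
    by (simp add: simple_root_def if_distrib[of "\<lambda>x. _ * x * _"] sum.delta cong: if_cong)
  then show ?thesis by (simp add: B_def)
qed

lemma B_comb:
  assumes "i \<in> I"
  shows "B (\<lambda>k. \<beta> k + x * \<gamma> k) (simple_root i) = B \<beta> (simple_root i) + x * B \<gamma> (simple_root i)"
  using assms by (simp add: B_simple algebra_simps sum.distrib sum_distrib_left)

lemma B_simple_simple:
  assumes "i \<in> I" "j \<in> I" shows "B (simple_root j) (simple_root i) = form_coeff j i"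
  unfolding B_simple[OF assms(1)] using assms finite_index
  by (simp add: simple_root_def if_distrib[of "\<lambda>x. x * _"] sum.delta cong: if_cong)

lemma form_coeff_self: "i \<in> I \<Longrightarrow> form_coeff i i = 1"
  by (simp add: form_coeff_def m_self)

lemma form_coeff_sym: "i \<in> I \<Longrightarrow> j \<in> I \<Longrightarrow> form_coeff i j = form_coeff j i"
  by (simp add: form_coeff_def m_sym)

lemma reflection_square:
  assumes "i \<in> I" shows "reflection i (reflection i v) = v"
proof -
  have "reflection i v = (\<lambda>k. v k + (- 2 * B v (simple_root i)) * simple_root i k)"
    by (auto simp: reflection_def)
  then have "B (reflection i v) (simple_root i) = - B v (simple_root i)"
    by (simp only: B_comb[OF assms] B_simple_simple[OF assms assms] form_coeff_self[OF assms])
  then show ?thesis by (simp add: reflection_def)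
qed

lemma reflection_pair_pow:
  assumes i: "i \<in> I" and j: "j \<in> I" and c: "form_coeff i j = - cos t" and t: "sin t \<noteq> 0"
    and ab: "a = B v (simple_root i)" "b = B v (simple_root j)"
  shows "((\<lambda>v. reflection i (reflection j v)) ^^ n) v = (\<lambda>k. v k
     + (- 2 * (a * sin (n*t) * sin (n*t) + b * sin (n*t) * sin ((n+1)*t)) / (sin t)^2) * simple_root i k
     + (- 2 * (b * sin (n*t) * sin (n*t) + a * sin (n*t) * sin ((n-1)*t)) / (sin t)^2) * simple_root j k)"
proof (induction n)
  case 0
  then show ?case by simp
next
  case (Suc n)
  define S where "S = sin (n*t)"
  define D where "D = cos (n*t)"
  define p where "p = sin t"
  define q where "q = cos t"
  have q2: "p*p + q*q = 1" "D*D + S*S = 1" unfolding p_def q_def S_def D_def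
    using sin_cos_squared_add by (simp_all add: power2_eq_square add.commute)
  have s1: "sin ((real n+1)*t) = S*q + D*p" "sin ((real n-1)*t) = S*q - D*p"
    "sin (real (Suc n) * t) = S*q + D*p" "sin ((real (Suc n) - 1)*t) = S"
    by (simp_all add: algebra_simps sin_add sin_diff S_def D_def p_def q_def)
  have s2: "sin ((real (Suc n) + 1)*t) = (S*q + D*p)*q + (D*q - S*p)*p"
  proof -
    have "(real (Suc n) + 1)*t = (n*t + t) + t" by (simp add: algebra_simps)
    then show ?thesis by (simp only: sin_add cos_add S_def D_def p_def q_def)
  qed
  define x where "x = (- 2 * (a * S * S + b * S * (S*q+D*p)) / p^2)"
  define y where "y = (- 2 * (b * S * S + a * S * (S*q-D*p)) / p^2)"
  define w where "w = (\<lambda>k. v k + x * simple_root i k + y * simple_root j k)"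
  have IH: "((\<lambda>v. reflection i (reflection j v)) ^^ n) v = w"
    using Suc.IH by (simp add: w_def x_def y_def s1 S_def[symmetric] p_def[symmetric])
  have Bi: "B w (simple_root i) = a + x - y * q"
    unfolding w_def using B_comb[OF i, of "\<lambda>k. v k + x * simple_root i k" y "simple_root j"]
      B_comb[OF i, of v x "simple_root i"] c form_coeff_sym[OF i j] form_coeff_self[OF i]
      B_simple_simple i j ab q_def by simp
  have Bj: "B w (simple_root j) = b - x * q + y"
    unfolding w_def using B_comb[OF j, of "\<lambda>k. v k + x * simple_root i k" y "simple_root j"]
      B_comb[OF j, of v x "simple_root i"] c form_coeff_sym[OF i j] form_coeff_self[OF j]
      B_simple_simple i j ab q_def by simp
  define y' where "y' = y - 2 * (b - x * q + y)"
  have rj: "reflection j w = (\<lambda>k. w k + (- 2 * (b - x * q + y)) * simple_root j k)"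
    by (simp add: reflection_def Bj fun_eq_iff algebra_simps)
  have Bij: "B (reflection j w) (simple_root i) = a + x - y * q + 2 * (b - x * q + y) * q"
    unfolding rj B_comb[OF i] Bi B_simple_simple[OF i j] form_coeff_sym[OF i j, symmetric] c q_def
    by (simp add: algebra_simps)
  have rij: "reflection i (reflection j w) =
     (\<lambda>k. v k + (x - 2 * (a + x - y' * q)) * simple_root i k + y' * simple_root j k)"
    unfolding reflection_def[of i] Bij unfolding rj unfolding w_def y'_def
    by (simp add: fun_eq_iff algebra_simps)
  have p0: "p \<noteq> 0" using t p_def by simp
  have "q*q = 1 - p*p" "D*D = 1 - S*S" using q2 by linarith+
  then have k: "S*S - p*p - (q*q)*(S*S) + (D*D)*(p*p) = 0"
    by (simp only:) (simp add: right_diff_distrib left_diff_distrib)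
  have xp: "x * p^2 = - 2 * (a * S * S + b * S * (S*q+D*p))"
    and yp: "y * p^2 = - 2 * (b * S * S + a * S * (S*q-D*p))"
    using p0 by (simp_all add: x_def y_def)
  have "y' * p^2 = - y * p^2 - 2 * b * p^2 + 2 * q * (x * p^2)"
    by (simp add: y'_def algebra_simps)
  also have "\<dots> = - 2 * (b * (S*q+D*p) * (S*q+D*p) + a * (S*q+D*p) * S)"
    using arg_cong[OF k, of "\<lambda>z. 2 * b * z"] unfolding xp minus_mult_left[symmetric] yp
    by (simp add: algebra_simps power2_eq_square)
  finally have yp': "y' * p^2 = \<dots>" .
  have "(x - 2 * (a + x - y' * q)) * p^2 = - (x * p^2) - 2 * a * p^2 + 2 * q * (y' * p^2)"
    by (simp add: algebra_simps)
  also have "\<dots> = - 2 * (a * (S*q+D*p) * (S*q+D*p) + b * (S*q+D*p) * ((S*q + D*p)*q + (D*q - S*p)*p))"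
    using arg_cong[OF k, of "\<lambda>z. 2 * a * z"] arg_cong[OF q2(1), of "\<lambda>z. 2 * b * (S*q+D*p) * S * z"]
    unfolding xp yp' by (simp add: algebra_simps power2_eq_square)
  finally have "(x - 2 * (a + x - y' * q)) * p^2 = \<dots>" .
  with yp' have "x - 2 * (a + x - y' * q) = 
      - 2 * (a * (S*q+D*p) * (S*q+D*p) + b * (S*q+D*p) * ((S*q + D*p)*q + (D*q - S*p)*p)) / p^2"
    "y' = - 2 * (b * (S*q+D*p) * (S*q+D*p) + a * (S*q+D*p) * S) / p^2"
    using p0 by (simp_all add: eq_divide_eq)
  then show ?case using IH rij by (simp only: s1 s2 p_def[symmetric] funpow.simps comp_def)
qed

lemma reflection_relation:
  assumes i: "i \<in> I" and j: "j \<in> I"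
  shows "((\<lambda>v. reflection i (reflection j v)) ^^ m i j) v = v"
proof -
  consider "i = j" | "m i j = 0" | "i \<noteq> j" "m i j \<ge> 2"
    using m_neq_one[OF i j] by fastforce
  then show ?thesis
  proof cases
    case 1
    then show ?thesis using reflection_square[OF i] m_self[OF i] by simp
  next
    case 2
    then show ?thesis by simp
  next
    case 3
    define t where "t = pi / m i j"
    have "0 < t" "t < pi" using 3 pi_gt_zero by (auto simp: t_def divide_less_eq)
    then have "sin t \<noteq> 0" using sin_gt_zero by force
    moreover have "sin (m i j * t) = 0" using 3 by (simp add: t_def)
    moreover have "form_coeff i j = - cos t" using 3 by (simp add: form_coeff_def t_def)
    ultimately show ?thesis using reflection_pair_pow[OF i j, of t _ v _ "m i j"] by simp
  qed
qed

lemma word_equiv_reflection: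
  "word_equiv m I xs ys \<Longrightarrow> foldr reflection xs = foldr reflection ys"
proof (induction rule: word_equiv.induct)
  case (relation i j xs ys)
  have "foldr reflection (concat (replicate n [i, j])) v
      = ((\<lambda>v. reflection i (reflection j v)) ^^ n) v" for n v
    by (induction n) auto
  then show ?case using relation by (auto simp: reflection_relation)
qed auto

lemma word_val_closed: "set xs \<subseteq> I \<Longrightarrow> word_val W s xs \<in> carrier W"
  by (induction xs) (auto simp: word_val_def gen_closed)

lemma word_val_append:
  "set xs \<subseteq> I \<Longrightarrow> set ys \<subseteq> I \<Longrightarrow> word_val W s (xs @ ys) = word_val W s xs \<otimes> word_val W s ys"
proof (induction xs)
  case Nil
  then show ?case using word_val_closed[of ys] by (simp add: word_val_def)
next
  case (Cons x xs)
  then show ?case using word_val_closed[of ys] word_val_closed[of xs] gen_closed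
    by (simp add: word_val_def m_assoc)
qed

lemma word_val_rev: "set xs \<subseteq> I \<Longrightarrow> word_val W s (rev xs) = inv (word_val W s xs)"
proof (induction xs)
  case Nil
  then show ?case by (simp add: word_val_def)
next
  case (Cons x xs)
  have "word_val W s (rev (x # xs)) = inv (word_val W s xs) \<otimes> s x"
    using Cons word_val_append[of "rev xs" "[x]"] gen_closed by (simp add: word_val_def)
  moreover have "word_val W s (x # xs) = s x \<otimes> word_val W s xs" by (simp add: word_val_def)
  ultimately show ?case
    using Cons word_val_closed[of xs] gen_closed inv_gen by (simp add: inv_mult_group)
qed

lemma foldr_reflection_rev:
  "set xs \<subseteq> I \<Longrightarrow> foldr reflection (rev xs) (foldr reflection xs v) = v"
  by (induction xs arbitrary: v) (auto simp: reflection_square)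

lemma foldr_reflection_unique:
  assumes "set xs \<subseteq> I" "set ys \<subseteq> I" "word_val W s xs = word_val W s ys"
  shows "foldr reflection xs = foldr reflection ys"
proof
  fix v
  have "word_val W s (xs @ rev ys) = \<one>"
    using assms word_val_append[of xs "rev ys"] word_val_rev[of ys] word_val_closed[of ys] by simp
  then have "word_equiv m I (xs @ rev ys) []"
    using presented[of "xs @ rev ys"] assms by (simp add: m_def[abs_def])
  then have "foldr reflection (xs @ rev ys) = foldr reflection []" by (rule word_equiv_reflection)
  then have "foldr reflection xs (foldr reflection (rev ys) (foldr reflection ys v))
      = foldr reflection ys v" by (simp add: fun_eq_iff)
  then show "foldr reflection xs v = foldr reflection ys v"
    using foldr_reflection_rev[of ys] assms by simp
qed

lemma act_word: "set xs \<subseteq> I \<Longrightarrow> act (word_val W s xs) = foldr reflection xs"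
  unfolding act_def by (rule the_equality) (auto intro: foldr_reflection_unique)

lemma ex_word:
  assumes "w \<in> carrier W" obtains xs where "set xs \<subseteq> I" "word_val W s xs = w"
proof -
  have "w \<in> generate W (s ` I)" using assms generated by simp
  then have "\<exists>xs. set xs \<subseteq> I \<and> word_val W s xs = w"
  proof (induction rule: generate.induct)
    case one
    then show ?case by (intro exI[of _ "[]"]) (simp add: word_val_def)
  next
    case (incl h)
    then obtain i where "i \<in> I" "h = s i" by auto
    then show ?case using gen_closed by (intro exI[of _ "[i]"]) (simp add: word_val_def)
  next
    case (inv h)
    then obtain i where "i \<in> I" "h = s i" by auto
    then show ?case using gen_closed inv_gen by (intro exI[of _ "[i]"]) (simp add: word_val_def)
  next
    case (eng h1 h2)
    then obtain xs ys where "set xs \<subseteq> I" "word_val W s xs = h1" "set ys \<subseteq> I" "word_val W s ys = h2"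
      by auto
    then show ?case using word_val_append by (intro exI[of _ "xs @ ys"]) simp
  qed
  then show ?thesis using that by blast
qed

lemma act_gen: "i \<in> I \<Longrightarrow> act (s i) = reflection i"
  using act_word[of "[i]"] gen_closed by (simp add: word_val_def fun_eq_iff)

lemma act_mult:
  assumes "w \<in> carrier W" "w' \<in> carrier W" shows "act (w \<otimes> w') = act w \<circ> act w'"
proof -
  obtain xs ys where "set xs \<subseteq> I" "word_val W s xs = w" "set ys \<subseteq> I" "word_val W s ys = w'"
    using ex_word assms by metis
  then show ?thesis
    using act_word[of "xs @ ys"] act_word[of xs] act_word[of ys] word_val_append[of xs ys]
    by (simp add: comp_def) auto
qed

end

end

theory Submission
  imports Defs
begin

text \<open>
  The roots of \<open>R L\<close> whose hyperplanes separate \<open>u\<close> from \<open>L\<close> can only decrease under toggles, so on a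
  periodic orbit of \<open>Pro\<close> outside \<open>L\<close> they form a constant nonempty set. Choose \<open>\<sigma>\<close> in it nearest
  to being positive. Then \<open>act v \<sigma>\<close> has nonnegative inner product with \<open>simple_root i\<close> whenever the
  toggle at \<open>i\<close> leaves the point \<open>v\<close> of the orbit fixed. Sum \<open>act v \<sigma>\<close> over the orbit: by
  periodicity the contributions of the toggles that move cancel, which makes the sum dominant for an
  invariant inner product. But it is a sum of negative roots, hence its square norm is at most 0,
  which is impossible.
\<close>

context coxeter_system
begin

section \<open>Linearity of the action\<close>

lemma reflection_comb:
  assumes "i \<in> I"
  shows "reflection i (\<lambda>k. a * x k + b * y k) = (\<lambda>k. a * reflection i x k + b * reflection i y k)"
  using assms by (simp add: reflection_def B_simple algebra_simps sum.distrib sum_distrib_left fun_eq_iff)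

lemma act_comb:
  assumes "w \<in> carrier W"
  shows "act w (\<lambda>k. a * x k + b * y k) = (\<lambda>k. a * act w x k + b * act w y k)"
proof -
  obtain xs where xs: "set xs \<subseteq> I" "word_val W s xs = w" using ex_word[OF assms] .
  have "foldr reflection xs (\<lambda>k. a * x k + b * y k) =
      (\<lambda>k. a * foldr reflection xs x k + b * foldr reflection xs y k)"
    using xs(1) by (induction xs) (auto simp: reflection_comb)
  then show ?thesis using act_word[OF xs(1)] xs(2) by simp
qed

lemma act_add: "w \<in> carrier W \<Longrightarrow> act w (\<lambda>k. x k + b * y k) = (\<lambda>k. act w x k + b * act w y k)"
  using act_comb[of w 1 x b y] by simp

lemma act_scale: "w \<in> carrier W \<Longrightarrow> act w (\<lambda>k. a * x k) = (\<lambda>k. a * act w x k)"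
  using act_comb[of w a x 0 x] by simp

lemma act_one: "act \<one> x = x"
  using act_word[of "[]"] by (simp add: word_val_def)

lemma act_mult_apply:
  "w \<in> carrier W \<Longrightarrow> w' \<in> carrier W \<Longrightarrow> act (w \<otimes> w') x = act w (act w' x)"
  by (simp add: act_mult)

lemma act_inv: "w \<in> carrier W \<Longrightarrow> act (inv w) (act w x) = x" "w \<in> carrier W \<Longrightarrow> act w (act (inv w) x) = x"
  by (simp_all add: act_mult_apply[symmetric] act_one)

lemma reflection_simple_self: "i \<in> I \<Longrightarrow> reflection i (simple_root i) = (\<lambda>k. - simple_root i k)"
  by (simp add: reflection_def B_simple_simple form_coeff_self)

lemma rootsI: "w \<in> carrier W \<Longrightarrow> i \<in> I \<Longrightarrow> act w (simple_root i) \<in> roots"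
  by (auto simp: roots_def)

lemma act_roots:
  assumes "w \<in> carrier W" "\<beta> \<in> roots" shows "act w \<beta> \<in> roots"
proof -
  obtain g i where g: "g \<in> carrier W" "i \<in> I" "\<beta> = act g (simple_root i)"
    using assms(2) by (auto simp: roots_def)
  then show ?thesis using rootsI[of "w \<otimes> g" i] assms(1) by (simp add: act_mult_apply)
qed

lemma simple_root_in_roots: "i \<in> I \<Longrightarrow> simple_root i \<in> roots"
  using rootsI[of \<one> i] by (simp add: act_one)

text \<open>Vectors are functions on the whole index type; vanishing off \<open>I\<close> lets
  equalities between roots be checked on \<open>I\<close> alone.\<close>

lemma root_support:
  assumes "\<beta> \<in> roots" "j \<notin> I" shows "\<beta> j = 0"
proof -
  obtain w i where w: "w \<in> carrier W" "i \<in> I" "\<beta> = act w (simple_root i)"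
    using assms(1) by (auto simp: roots_def)
  obtain xs where xs: "set xs \<subseteq> I" "word_val W s xs = w" using ex_word[OF w(1)] .
  have "foldr reflection xs (simple_root i) j = 0"
    using xs(1) assms(2) w(2) by (induction xs) (auto simp: reflection_def simple_root_def)
  then show ?thesis using act_word[OF xs(1)] xs(2) w(3) by simp
qed

lemma root_nonzero:
  assumes "\<beta> \<in> roots" shows "\<exists>j\<in>I. \<beta> j \<noteq> 0"
proof (rule ccontr)
  assume "\<not> ?thesis"
  \<comment> \<open>The zero vector is written as a multiple so that \<open>act_scale\<close>
    applies to it.\<close>
  then have z: "\<beta> = (\<lambda>k. 0 * \<beta> k)" using root_support[OF assms] by (auto simp: fun_eq_iff)
  obtain w i where w: "w \<in> carrier W" "i \<in> I" "\<beta> = act w (simple_root i)"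
    using assms by (auto simp: roots_def)
  have "simple_root i = act (inv w) \<beta>" using w act_inv by simp
  also have "\<dots> = (\<lambda>k. 0 * act (inv w) \<beta> k)"
    using act_scale[of "inv w" 0 \<beta>] z w(1) by simp
  finally have "simple_root i i = 0" by (simp add: fun_eq_iff)
  then show False by (simp add: simple_root_def)
qed

lemma pos_roots_iff: "\<beta> \<in> pos_roots \<longleftrightarrow> \<beta> \<in> roots \<and> (\<forall>i\<in>I. 0 \<le> \<beta> i)"
proof -
  have eq: "(\<Sum>i\<in>I. a i * simple_root i j) = (if j \<in> I then a j else 0)" for a :: "'i \<Rightarrow> real" and j
    using finite_index
    by (simp add: simple_root_def if_distrib[of "\<lambda>x. _ * x"] sum.delta' cong: if_cong)
  show ?thesis
    unfolding pos_roots_def eq by (auto simp: root_support fun_eq_iff intro: exI[of _ \<beta>])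
qed

section \<open>Every root is positive or negative\<close>

definition len :: "'a \<Rightarrow> nat" where
  "len w = (LEAST n. \<exists>xs. set xs \<subseteq> I \<and> word_val W s xs = w \<and> length xs = n)"

lemma len_le: "set xs \<subseteq> I \<Longrightarrow> len (word_val W s xs) \<le> length xs"
  unfolding len_def by (rule Least_le) auto

lemma len_word:
  assumes "w \<in> carrier W" obtains xs where "set xs \<subseteq> I" "word_val W s xs = w" "length xs = len w"
proof -
  obtain ys where "set ys \<subseteq> I" "word_val W s ys = w" using ex_word[OF assms] .
  then have "\<exists>n. \<exists>xs. set xs \<subseteq> I \<and> word_val W s xs = w \<and> length xs = n" by auto
  from LeastI_ex[OF this] show ?thesis using that unfolding len_def by blast
qed

lemma len_mult_word:
  assumes "w \<in> carrier W" "set xs \<subseteq> I" shows "len (w \<otimes> word_val W s xs) \<le> len w + length xs"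
proof -
  obtain ys where "set ys \<subseteq> I" "word_val W s ys = w" "length ys = len w" using len_word[OF assms(1)] .
  then show ?thesis using len_le[of "ys @ xs"] word_val_append[of ys xs] assms by simp
qed

text \<open>The alternating word of length \<open>n\<close> in \<open>a\<close> and \<open>b\<close> whose last letter is \<open>a\<close>.\<close>

fun alt :: "'i \<Rightarrow> 'i \<Rightarrow> nat \<Rightarrow> 'i list" where
  "alt a b 0 = []"
| "alt a b (Suc n) = (if even n then a else b) # alt a b n"

lemma alt_snoc: "alt a b (Suc n) = alt b a n @ [a]"
  by (induction n) auto

lemma length_alt [simp]: "length (alt a b n) = n"
  by (induction n) auto

lemma set_alt: "set (alt a b n) \<subseteq> {a, b}"
  by (induction n) auto

text \<open>Isolates a suffix of length \<open>m a b\<close>, to which the braid relation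
  applies.\<close>

lemma alt_add: "\<exists>xs. set xs \<subseteq> {a, b} \<and> length xs = n \<and> alt a b (n + k) = xs @ alt a b k"
proof (induction n)
  case (Suc n)
  then obtain xs where "set xs \<subseteq> {a, b}" "length xs = n" "alt a b (n + k) = xs @ alt a b k" by auto
  then show ?case by (intro exI[of _ "(if even (n + k) then a else b) # xs"]) auto
qed simp

declare alt.simps(2) [simp del]

lemma word_val_Cons: "word_val W s (x # xs) = s x \<otimes> word_val W s xs"
  by (simp add: word_val_def)

lemma word_val_alt_closed: "a \<in> I \<Longrightarrow> b \<in> I \<Longrightarrow> word_val W s (alt a b n) \<in> carrier W"
  using set_alt[of a b n] by (intro word_val_closed) auto

lemma word_val_alt_snoc:
  assumes "a \<in> I" "b \<in> I"
  shows "word_val W s (alt a b (Suc n)) = word_val W s (alt b a n) \<otimes> s a"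
  using assms set_alt[of b a n] word_val_append[of "alt b a n" "[a]"] gen_closed
  unfolding alt_snoc by (auto simp: word_val_def)

lemma word_val_alt_even:
  assumes "a \<in> I" "b \<in> I"
  shows "word_val W s (alt a b (2 * n)) = (s b \<otimes> s a) [^] n"
proof (induction n)
  case (Suc n)
  have "word_val W s (alt a b (2 * Suc n)) = (word_val W s (alt a b (2 * n)) \<otimes> s b) \<otimes> s a"
    using word_val_alt_snoc[OF assms] word_val_alt_snoc[OF assms(2,1)] by simp
  then show ?case using Suc assms gen_closed word_val_alt_closed by (simp add: m_assoc)
qed (simp add: word_val_def)

text \<open>For \<open>j = 0\<close> this is the Coxeter relation. Each further step cancels the
  last letter on one side, which appends it on the other, and swaps \<open>a\<close> and
  \<open>b\<close>. At \<open>j = m a b\<close> it becomes the braid relation.\<close>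

lemma word_val_alt_complement:
  assumes "a \<in> I" "b \<in> I" "j \<le> 2 * m a b"
  shows "word_val W s (alt a b (2 * m a b - j)) = word_val W s (alt b a j)"
  using assms
proof (induction j arbitrary: a b)
  case 0
  then show ?case using word_val_alt_even[of a b "m a b"] m_sym[of a b] gen_closed
    by (simp add: m_def word_val_def)
next
  case (Suc j)
  define k where "k = 2 * m a b - Suc j"
  have k: "2 * m b a - j = Suc k" using Suc.prems m_sym[of a b] by (simp add: k_def)
  have "word_val W s (alt b a (Suc k)) = word_val W s (alt a b j)"
    using Suc.IH[of b a] Suc.prems m_sym[of a b] k by simp
  then have "word_val W s (alt a b k) \<otimes> s b \<otimes> s b = word_val W s (alt a b j) \<otimes> s b"
    using word_val_alt_snoc[of b a k] Suc.prems by simp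
  then show ?case
    using Suc.prems word_val_alt_snoc[of b a j] gen_closed word_val_alt_closed gen_square
    by (simp add: m_assoc k_def)
qed

lemma braid:
  assumes "a \<in> I" "b \<in> I" shows "word_val W s (alt a b (m a b)) = word_val W s (alt b a (m a b))"
  using word_val_alt_complement[OF assms, of "m a b"] by simp

text \<open>
  The coefficients of the roots of the dihedral group generated by \<open>s a\<close> and \<open>s b\<close>; for
  \<open>m a b = 0\<close> they are the limits of the quotients of sines as the angle tends to 0.
\<close>

definition dihedral_coeff :: "'i \<Rightarrow> 'i \<Rightarrow> nat \<Rightarrow> real" where
  "dihedral_coeff a b k =
     (if m a b = 0 then real k else sin (real k * (pi / m a b)) / sin (pi / m a b))"

text \<open>If \<open>m a b\<close> is nonzero, the angles up to \<open>k = m a b\<close> stay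
  between 0 and pi.\<close>

lemma dihedral_coeff_nonneg:
  assumes "m a b = 0 \<or> k \<le> m a b" shows "0 \<le> dihedral_coeff a b k"
proof (cases "m a b = 0")
  case False
  define r where "r = real (m a b)"
  have r: "r \<ge> 1" "real k \<le> r" using False assms by (auto simp: r_def)
  have "real k * pi \<le> r * pi" using r by (intro mult_right_mono) auto
  then have "real k * (pi / r) \<le> pi" using r by (simp add: divide_le_eq mult.commute)
  moreover have "pi * 1 \<le> pi * r" using r by (intro mult_left_mono) auto
  then have "pi / r \<le> pi" using r by (simp add: divide_le_eq)
  ultimately show ?thesis
    using False r unfolding dihedral_coeff_def r_def[symmetric]
    by (auto intro!: divide_nonneg_nonneg sin_ge_zero)
qed (simp add: dihedral_coeff_def)

text \<open>The Chebyshev recurrence for sines of multiples of \<open>t\<close>, as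
  \<open>form_coeff a b = - cos t\<close>. For \<open>m a b = 0\<close> it degenerates to that of an
  arithmetic progression.\<close>

lemma dihedral_coeff_Suc_Suc:
  "dihedral_coeff a b (Suc (Suc k)) =
     - 2 * form_coeff a b * dihedral_coeff a b (Suc k) - dihedral_coeff a b k"
proof (cases "m a b = 0")
  case False
  define t where "t = pi / m a b"
  have e: "real (Suc (Suc k)) * t = real (Suc k) * t + t" "real k * t = real (Suc k) * t - t"
    by (simp_all add: algebra_simps)
  have "sin (real (Suc (Suc k)) * t) = 2 * cos t * sin (real (Suc k) * t) - sin (real k * t)"
    unfolding e sin_add sin_diff by (simp add: algebra_simps)
  then show ?thesis
    using False unfolding dihedral_coeff_def form_coeff_def
    by (simp add: t_def[symmetric] diff_divide_distrib)
qed (simp add: dihedral_coeff_def form_coeff_def)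

text \<open>A prepended letter changes only the coefficient of its own simple root and advances it
  two places in the recurrence. The letters alternate, hence the parities.\<close>

lemma dihedral_root:
  assumes a: "a \<in> I" and b: "b \<in> I" and ne: "a \<noteq> b"
  shows "foldr reflection (alt a b k) (simple_root b) = (\<lambda>j.
      dihedral_coeff a b (if even k then k else Suc k) * simple_root a j +
      dihedral_coeff a b (if even k then Suc k else k) * simple_root b j)"
proof (induction k)
  case 0
  \<comment> \<open>Since \<open>m a b\<close> is not 1, the sine in the denominator is nonzero and
    the coefficient with index 1 equals 1.\<close>
  have "m a b \<noteq> 0 \<Longrightarrow> sin (pi / m a b) \<noteq> 0"
  proof -
    assume "m a b \<noteq> 0"
    then have "1 < real (m a b)" using m_neq_one[OF a b ne] by linarith
    then have "0 < pi / m a b" "pi / m a b < pi" by (auto simp: divide_less_eq)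
    then show ?thesis using sin_gt_zero by force
  qed
  then show ?case by (simp add: dihedral_coeff_def)
next
  case (Suc k)
  have refl: "reflection i (\<lambda>j. x * simple_root i j + y * simple_root l j) =
      (\<lambda>j. (- 2 * form_coeff i l * y - x) * simple_root i j + y * simple_root l j)"
    if "i \<in> I" "l \<in> I" for i l x y
    unfolding reflection_comb[OF that(1)] reflection_simple_self[OF that(1)]
    using that by (simp add: reflection_def B_simple_simple form_coeff_sym[of i l] fun_eq_iff algebra_simps)
  show ?case
  proof (cases "even k")
    case True
    then show ?thesis
      using Suc refl[OF a b] by (simp add: alt.simps(2) dihedral_coeff_Suc_Suc[of a b k])
  next
    case False
    then show ?thesis
      using Suc refl[OF b a, of "dihedral_coeff a b k" "dihedral_coeff a b (Suc k)"]
        form_coeff_sym[OF a b]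
      by (simp add: alt.simps(2) dihedral_coeff_Suc_Suc[of a b k] add.commute[of "_ * simple_root a _"])
  qed
qed

text \<open>
  Split off from \<open>w\<close> the longest alternating suffix in two letters; what remains lengthens under
  both letters, so that the induction hypothesis applies to it.
\<close>

lemma act_simple_root_nonneg:
  assumes "w \<in> carrier W" "b \<in> I" "len w \<le> len (w \<otimes> s b)" "j \<in> I"
  shows "0 \<le> act w (simple_root b) j"
  using assms
proof (induction "len w" arbitrary: w b rule: less_induct)
  case less
  note w = less.prems(1) and b = less.prems(2)
  obtain xs where xs: "set xs \<subseteq> I" "word_val W s xs = w" "length xs = len w" using len_word[OF w] .
  show ?case
  proof (cases xs rule: rev_cases)
    case Nil
    then have "w = \<one>" using xs(2) by (simp add: word_val_def)
    then show ?thesis by (simp add: act_one simple_root_def)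
  next
    case (snoc ys a)
    have a: "a \<in> I" and ys: "set ys \<subseteq> I" using xs(1) snoc by auto
    define y where "y = word_val W s ys"
    have y: "y \<in> carrier W" "w = y \<otimes> s a"
      using xs ys snoc word_val_append[of ys "[a]"] word_val_closed[of ys] a gen_closed
      by (auto simp: y_def word_val_def)
    have leny: "len y < len w" using len_le[OF ys] xs(3) snoc by (simp add: y_def)
    have "w \<otimes> s a = y" using y a gen_closed gen_square by (simp add: m_assoc)
    then have ne: "a \<noteq> b" using leny less.prems(3) by auto
    \<comment> \<open>The factorization is additive in length: the reverse inequality always
      holds.\<close>
    define P where "P k \<longleftrightarrow> (\<exists>v. v \<in> carrier W \<and> w = v \<otimes> word_val W s (alt a b k) \<and> len v + k \<le> len w)" for k
    have "P (Suc 0)"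
      unfolding P_def using y leny a gen_closed by (intro exI[of _ y]) (auto simp: alt.simps(2) word_val_def)
    moreover have "P k \<Longrightarrow> k \<le> len w" for k by (auto simp: P_def)
    ultimately obtain k where k: "P k" "k \<ge> Suc 0" "\<And>k'. P k' \<Longrightarrow> k' \<le> k"
      using GreatestI_nat[of P "Suc 0" "len w"] Greatest_le_nat[of P _ "len w"] by metis
    obtain v where v: "v \<in> carrier W" "w = v \<otimes> word_val W s (alt a b k)" "len v + k \<le> len w"
      using k(1) by (auto simp: P_def)
    have setalt: "set (alt a b n) \<subseteq> I" for n using set_alt[of a b n] a b by auto
    obtain h where h: "k = Suc h" using k(2) by (cases k) auto
    \<comment> \<open>\<open>x\<close> is the first letter of the alternating suffix,
      \<open>x'\<close> the other one. If \<open>x\<close> shortened \<open>v\<close>, then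
      \<open>w\<close> would have a word shorter than its length; if \<open>x'\<close> did, the
      suffix could be extended.\<close>
    define x x' where "x = (if even h then a else b)" and "x' = (if even h then b else a)"
    have xI: "x \<in> I" "x' \<in> I" using a b by (auto simp: x_def x'_def)
    have "len v \<le> len (v \<otimes> s x)"
    proof (rule ccontr)
      assume "\<not> ?thesis"
      moreover have "w = (v \<otimes> s x) \<otimes> word_val W s (alt a b h)"
        using v xI h gen_closed word_val_alt_closed[OF a b] by (simp add: alt.simps(2) word_val_Cons x_def m_assoc)
      then have "len w \<le> len (v \<otimes> s x) + h"
        using len_mult_word[of "v \<otimes> s x" "alt a b h"] v(1) xI gen_closed setalt by simp
      ultimately show False using v(3) h by simp
    qed
    moreover have "len v \<le> len (v \<otimes> s x')"
    proof (rule ccontr)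
      assume "\<not> ?thesis"
      moreover have "w = (v \<otimes> s x') \<otimes> word_val W s (alt a b (Suc k))"
      proof -
        have "alt a b (Suc k) = x' # alt a b k"
          unfolding alt.simps(2)[of a b k] using h by (simp add: x'_def)
        then have "(v \<otimes> s x') \<otimes> word_val W s (alt a b (Suc k))
            = v \<otimes> (s x' \<otimes> s x') \<otimes> word_val W s (alt a b k)"
          using v(1) xI gen_closed word_val_alt_closed[OF a b, of k]
          by (simp add: word_val_Cons m_assoc)
        then show ?thesis using v xI gen_square by simp
      qed
      ultimately have "P (Suc k)"
        unfolding P_def using v(1,3) xI gen_closed by (intro exI[of _ "v \<otimes> s x'"]) auto
      then show False using k(3) by fastforce
    qed
    ultimately have la: "len v \<le> len (v \<otimes> s a)" "len v \<le> len (v \<otimes> s b)"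
      by (auto simp: x_def x'_def split: if_splits)
    have nn: "0 \<le> act v (simple_root a) j" "0 \<le> act v (simple_root b) j"
      using less.hyps[OF _ v(1) a la(1)] less.hyps[OF _ v(1) b la(2)] v(3) k(2) less.prems(4) by auto
    \<comment> \<open>By the braid relation a longer suffix could be rewritten to end in
      \<open>b\<close>, and \<open>s b\<close> would shorten \<open>w\<close>. The bound keeps the
      index \<open>Suc k\<close> within \<open>m a b\<close>.\<close>
    have km: "k < m a b" if m0: "m a b \<noteq> 0"
    proof (rule ccontr)
      assume "\<not> ?thesis"
      then have "k = (k - m a b) + m a b" by simp
      then obtain zs where zs: "set zs \<subseteq> {a, b}" "length zs = k - m a b"
        "alt a b k = zs @ alt a b (m a b)" using alt_add[of a b "k - m a b" "m a b"] by auto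
      have zI: "set zs \<subseteq> I" using zs a b by auto
      obtain n where n: "m a b = Suc n" using m0 by (cases "m a b") auto
      have "word_val W s (alt a b k) = word_val W s zs \<otimes> (word_val W s (alt a b n) \<otimes> s b)"
        using zs(3) word_val_append[OF zI setalt] braid[OF a b] word_val_alt_snoc[OF b a, of n] n by simp
      then have "w \<otimes> s b = v \<otimes> word_val W s (zs @ alt a b n)"
        using v(1,2) word_val_closed[OF zI] word_val_alt_closed[OF a b, of n] b gen_closed gen_square
          word_val_append[OF zI setalt] by (simp add: m_assoc)
      then have "len (w \<otimes> s b) \<le> len v + length (zs @ alt a b n)"
        using len_mult_word[OF v(1), of "zs @ alt a b n"] zI setalt by simp
      also have "\<dots> < len v + k" using zs(2) n \<open>\<not> k < m a b\<close> by simp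
      finally show False using v(3) less.prems(3) by simp
    qed
    have "act w (simple_root b) = act v (foldr reflection (alt a b k) (simple_root b))"
      using v act_mult word_val_alt_closed[OF a b] act_word[OF setalt] by simp
    also have "\<dots> = (\<lambda>j.
      dihedral_coeff a b (if even k then k else Suc k) * act v (simple_root a) j +
      dihedral_coeff a b (if even k then Suc k else k) * act v (simple_root b) j)"
      unfolding dihedral_root[OF a b ne] by (rule act_comb[OF v(1)])
    finally show ?thesis
      using nn km by (cases "m a b = 0")
        (auto intro!: add_nonneg_nonneg mult_nonneg_nonneg dihedral_coeff_nonneg)
  qed
qed

text \<open>If the root is not positive, \<open>s i\<close> shortens \<open>w\<close>, hence
  lengthens \<open>w \<otimes> s i\<close>, which sends the same simple root to the negative of the
  root.\<close>

lemma root_dichotomy: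
  assumes "\<beta> \<in> roots" "\<beta> \<notin> pos_roots" "j \<in> I" shows "\<beta> j \<le> 0"
proof -
  obtain w i where w: "w \<in> carrier W" "i \<in> I" "\<beta> = act w (simple_root i)"
    using assms(1) by (auto simp: roots_def)
  have "\<not> len w \<le> len (w \<otimes> s i)"
    using act_simple_root_nonneg[OF w(1,2)] w(3) assms(1,2) pos_roots_iff by auto
  moreover have "(w \<otimes> s i) \<otimes> s i = w" using w gen_closed gen_square by (simp add: m_assoc)
  ultimately have "0 \<le> act (w \<otimes> s i) (simple_root i) j"
    using act_simple_root_nonneg[of "w \<otimes> s i" i] w gen_closed assms(3) by simp
  moreover have "act (w \<otimes> s i) (simple_root i) = (\<lambda>k. - \<beta> k)"
    using w act_mult_apply[of w "s i"] gen_closed act_gen reflection_simple_self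
      act_scale[of w "-1" "simple_root i"] by simp
  ultimately show ?thesis by simp
qed

section \<open>Heights of roots\<close>

definition height :: "('i \<Rightarrow> real) \<Rightarrow> real" where
  "height \<beta> = (\<Sum>i\<in>I. \<beta> i)"

lemma height_pos:
  assumes "\<beta> \<in> pos_roots" shows "0 < height \<beta>"
proof -
  obtain j where j: "j \<in> I" "\<beta> j \<noteq> 0" using root_nonzero assms pos_roots_iff by blast
  then have "0 < \<beta> j" using assms pos_roots_iff by force
  then show ?thesis
    unfolding height_def using j(1) assms pos_roots_iff finite_index by (intro sum_pos2[of I j]) auto
qed

lemma height_neg:
  assumes "\<beta> \<in> roots" "\<beta> \<notin> pos_roots" shows "height \<beta> < 0"
proof -
  obtain j where j: "j \<in> I" "\<beta> j \<noteq> 0" using root_nonzero assms by blast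
  then have "0 < - \<beta> j" using root_dichotomy[OF assms j(1)] by simp
  then have "0 < (\<Sum>i\<in>I. - \<beta> i)"
    using j(1) root_dichotomy[OF assms] finite_index by (intro sum_pos2[of I j]) auto
  then show ?thesis by (simp add: height_def sum_negf)
qed

lemma height_add: "height (\<lambda>k. x k + b * y k) = height x + b * height y"
  by (simp add: height_def sum.distrib sum_distrib_left)

section \<open>The invariant inner product\<close>

text \<open>The standard inner product summed over the group to make it invariant. For infinite
  \<open>carrier W\<close> the sum is 0 by default, so definiteness assumes finiteness.\<close>

definition ip :: "('i \<Rightarrow> real) \<Rightarrow> ('i \<Rightarrow> real) \<Rightarrow> real" where
  "ip x y = (\<Sum>w\<in>carrier W. \<Sum>i\<in>I. act w x i * act w y i)"

lemma ip_sym: "ip x y = ip y x"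
  by (simp add: ip_def mult.commute)

lemma ip_comb: "ip (\<lambda>k. a * x k + b * y k) z = a * ip x z + b * ip y z"
proof -
  have "ip (\<lambda>k. a * x k + b * y k) z =
     (\<Sum>w\<in>carrier W. \<Sum>i\<in>I. (a * act w x i + b * act w y i) * act w z i)"
    unfolding ip_def by (intro sum.cong HOL.refl) (simp add: act_comb)
  then show ?thesis by (simp add: ip_def algebra_simps sum.distrib sum_distrib_left)
qed

lemma ip_sum: "finite A \<Longrightarrow> ip (\<lambda>k. \<Sum>a\<in>A. f a k) z = (\<Sum>a\<in>A. ip (f a) z)"
proof (induction A rule: finite_induct)
  case empty
  show ?case using ip_comb[of 0 "\<lambda>_. 0" 0 "\<lambda>_. 0" z] by simp
next
  case (insert a A)
  then show ?case using ip_comb[of 1 "f a" 1 "\<lambda>k. \<Sum>a\<in>A. f a k" z] by simp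
qed

lemma ip_act:
  assumes "g \<in> carrier W" shows "ip (act g x) (act g y) = ip x y"
proof -
  have "ip (act g x) (act g y) = (\<Sum>w\<in>carrier W. \<Sum>i\<in>I. act (w \<otimes> g) x i * act (w \<otimes> g) y i)"
    unfolding ip_def using assms by (intro sum.cong HOL.refl) (simp add: act_mult_apply)
  also have "\<dots> = ip x y"
    unfolding ip_def using assms
    by (intro sum.reindex_bij_witness[of _ "\<lambda>w. w \<otimes> inv g" "\<lambda>w. w \<otimes> g"]) (auto simp: m_assoc)
  finally show ?thesis .
qed

text \<open>The term of the identity is the standard sum of squares, and all other terms are
  nonnegative.\<close>

lemma ip_definite:
  assumes "finite (carrier W)" "ip x x \<le> 0" "j \<in> I" shows "x j = 0"
proof -
  have nn: "0 \<le> (\<Sum>i\<in>I. act w x i * act w x i)" for w by (intro sum_nonneg) auto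
  have "(\<Sum>i\<in>I. act \<one> x i * act \<one> x i) \<le> ip x x"
    unfolding ip_def using assms(1) nn by (intro member_le_sum) auto
  moreover have "x j * x j \<le> (\<Sum>i\<in>I. x i * x i)"
    using assms(3) finite_index by (intro member_le_sum) auto
  ultimately have "x j * x j \<le> 0" using assms(2) by (simp add: act_one)
  then show ?thesis using mult_le_0_iff by force
qed

lemma ip_simple_pos:
  assumes "finite (carrier W)" "i \<in> I" shows "0 < ip (simple_root i) (simple_root i)"
  using ip_definite[OF assms(1) _ assms(2), of "simple_root i"] by (force simp: simple_root_def)

text \<open>
  The generators act by reflections that are orthogonal for \<open>ip\<close> as well. Only this comparison is
  needed, not that \<open>B\<close> itself is positive definite.
\<close>

lemma ip_simple:
  assumes "i \<in> I" shows "ip v (simple_root i) = B v (simple_root i) * ip (simple_root i) (simple_root i)"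
proof -
  define \<alpha> where "\<alpha> = simple_root i"
  define b where "b = B v \<alpha>"
  have neg: "reflection i \<alpha> = (\<lambda>k. (-1) * \<alpha> k + 0 * \<alpha> k)"
    using reflection_simple_self[OF assms] by (simp add: \<alpha>_def)
  have rv: "reflection i v = (\<lambda>k. 1 * v k + (- 2 * b) * \<alpha> k)"
    by (simp add: reflection_def b_def \<alpha>_def fun_eq_iff)
  have "ip v \<alpha> = ip (reflection i \<alpha>) (reflection i v)"
    using ip_act[of "s i" v \<alpha>] assms gen_closed act_gen ip_sym by simp
  also have "\<dots> = - ip (reflection i v) \<alpha>"
    unfolding neg ip_comb by (simp add: ip_sym)
  also have "\<dots> = - ip v \<alpha> + 2 * b * ip \<alpha> \<alpha>"
    unfolding rv ip_comb by simp
  finally show ?thesis by (simp add: b_def \<alpha>_def)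
qed

section \<open>Toggles\<close>

lemma finite_roots: "finite (carrier W) \<Longrightarrow> finite roots"
proof -
  assume "finite (carrier W)"
  then have "finite ((\<lambda>(w, i). act w (simple_root i)) ` (carrier W \<times> I))" using finite_index by simp
  then show ?thesis by (rule rev_finite_subset) (auto simp: roots_def)
qed

lemma convex_set_carrier: "convex_set L \<Longrightarrow> L \<subseteq> carrier W"
  by (auto simp: convex_set_def)

lemma toggle_closed: "u \<in> carrier W \<Longrightarrow> i \<in> I \<Longrightarrow> toggle L i u \<in> carrier W"
  by (simp add: toggle_def gen_closed)

lemma fold_toggle_closed:
  "u \<in> carrier W \<Longrightarrow> set ks \<subseteq> I \<Longrightarrow> fold (toggle L) ks u \<in> carrier W"
  by (induction ks arbitrary: u) (auto simp: toggle_closed)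

section \<open>Roots separating an element from \<open>L\<close>\<close>

definition separating :: "'a set \<Rightarrow> 'a \<Rightarrow> ('i \<Rightarrow> real) set" where
  "separating L u = {\<beta> \<in> R L. act u \<beta> \<notin> pos_roots}"

text \<open>In \<open>separating_toggle\<close> a root is only known to be a positive multiple of
  another; membership in \<open>R L\<close> depends only on the ray.\<close>

lemma R_scale:
  assumes "\<beta> \<in> R L" "\<gamma> \<in> roots" "\<beta> = (\<lambda>k. c * \<gamma> k)" "0 < c" shows "\<gamma> \<in> R L"
proof -
  have "act g \<gamma> \<in> pos_roots" if "g \<in> L" for g
  proof -
    have g: "g \<in> carrier W" "act g \<beta> \<in> pos_roots" using assms(1) that by (auto simp: R_def half_space_def)
    then show ?thesis
      using assms(2-4) act_scale[of g c \<gamma>] act_roots[of g \<gamma>] by (auto simp: pos_roots_iff zero_le_mult_iff)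
  qed
  then show ?thesis using assms(1,2) by (auto simp: R_def half_space_def)
qed

text \<open>A newly separating root is positive at \<open>u\<close> and made negative by
  \<open>s i\<close>. As \<open>s i\<close> changes only coordinate \<open>i\<close>, its image
  under \<open>u\<close> is a positive multiple of \<open>simple_root i\<close>, and then the toggle
  would have been refused.\<close>

lemma separating_toggle:
  assumes u: "u \<in> carrier W" and i: "i \<in> I"
  shows "separating L (toggle L i u) \<subseteq> separating L u"
proof
  fix \<beta> assume b: "\<beta> \<in> separating L (toggle L i u)"
  show "\<beta> \<in> separating L u"
  proof (rule ccontr)
    assume nb: "\<beta> \<notin> separating L u"
    define \<gamma> where "\<gamma> = act u \<beta>"
    have R: "\<beta> \<in> R L" "\<beta> \<in> roots" and pos: "\<gamma> \<in> pos_roots"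
      using b nb by (auto simp: separating_def R_def \<gamma>_def)
    have tog: "toggle L i u = s i \<otimes> u" and nR: "act (inv u) (simple_root i) \<notin> R L"
      using b nb by (auto simp: toggle_def split: if_splits)
    have np: "reflection i \<gamma> \<notin> pos_roots"
      using b tog u i gen_closed act_mult_apply[of "s i" u] act_gen by (simp add: separating_def \<gamma>_def)
    have rt: "reflection i \<gamma> \<in> roots"
      using act_roots[of "s i" \<gamma>] act_gen i gen_closed pos by (simp add: pos_roots_iff)
    have "\<gamma> j = 0" if "j \<in> I" "j \<noteq> i" for j
      using root_dichotomy[OF rt np that(1)] pos that
      by (auto simp: reflection_def simple_root_def pos_roots_iff intro: antisym)
    then have \<gamma>: "\<gamma> = (\<lambda>k. \<gamma> i * simple_root i k)"
      using root_support[of \<gamma>] pos by (auto simp: fun_eq_iff simple_root_def pos_roots_iff)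
    obtain l where "l \<in> I" "\<gamma> l \<noteq> 0" using root_nonzero[of \<gamma>] pos pos_roots_iff by blast
    then have "\<gamma> i \<noteq> 0" using fun_cong[OF \<gamma>, of l] by auto
    then have c: "0 < \<gamma> i" using pos i by (force simp: pos_roots_iff)
    have "\<beta> = act (inv u) \<gamma>" using u act_inv by (simp add: \<gamma>_def)
    also have "\<dots> = (\<lambda>k. \<gamma> i * act (inv u) (simple_root i) k)"
      by (subst \<gamma>) (simp add: u act_scale)
    finally have "act (inv u) (simple_root i) \<in> R L"
      using R_scale[OF R(1) _ _ c] act_roots u i simple_root_in_roots by simp
    then show False using nR by simp
  qed
qed

lemma separating_fold:
  "u \<in> carrier W \<Longrightarrow> set ks \<subseteq> I \<Longrightarrow> separating L (fold (toggle L) ks u) \<subseteq> separating L u"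
proof (induction ks arbitrary: u)
  case (Cons k ks)
  have k: "k \<in> I" "set ks \<subseteq> I" using Cons.prems(2) by auto
  have "separating L (fold (toggle L) ks (toggle L k u)) \<subseteq> separating L (toggle L k u)"
    by (rule Cons.IH[OF toggle_closed[OF Cons.prems(1) k(1)] k(2)])
  also have "\<dots> \<subseteq> separating L u" by (rule separating_toggle[OF Cons.prems(1) k(1)])
  finally show ?case by simp
qed simp

lemma separating_nonempty:
  assumes "convex_set L" "u \<in> carrier W" "u \<notin> L" shows "separating L u \<noteq> {}"
proof -
  obtain A where A: "A \<subseteq> roots" "L = carrier W \<inter> (\<Inter>\<beta>\<in>A. half_space \<beta>)"
    using assms(1) by (auto simp: convex_set_def)
  then obtain \<beta> where "\<beta> \<in> A" "u \<notin> half_space \<beta>" using assms(2,3) by auto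
  then have "\<beta> \<in> separating L u" using A assms(2) by (auto simp: separating_def R_def half_space_def)
  then show ?thesis by auto
qed

text \<open>
  The ratio of the heights of \<open>act u \<beta>\<close> and \<open>act g \<beta>\<close> is maximized at \<open>\<sigma>\<close>. If the conclusion
  failed, the reflection of \<open>\<sigma>\<close> in the refusing wall \<open>t\<close> would have a larger ratio, so it would
  not separate \<open>v\<close> from \<open>L\<close>; but \<open>t\<close> is simple for \<open>v\<close>.
\<close>

lemma refused_toggle_ip_nonneg:
  assumes fin: "finite (carrier W)"
    and u: "u \<in> carrier W" and v: "v \<in> carrier W" and sep: "separating L v = separating L u"
    and g: "g \<in> L" "L \<subseteq> carrier W"
    and \<sigma>: "\<sigma> \<in> separating L u"
    and max: "\<And>\<beta>. \<beta> \<in> separating L u \<Longrightarrow>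
      height (act u \<beta>) / height (act g \<beta>) \<le> height (act u \<sigma>) / height (act g \<sigma>)"
    and i: "i \<in> I" and refused: "act (inv v) (simple_root i) \<in> R L"
  shows "0 \<le> ip (act v \<sigma>) (simple_root i)"
proof (rule ccontr)
  assume "\<not> ?thesis"
  then have "B (act v \<sigma>) (simple_root i) < 0"
    using ip_simple[OF i, of "act v \<sigma>"] ip_simple_pos[OF fin i] by (simp add: mult_less_0_iff not_le)
  then obtain c where c: "c > 0" "c = - 2 * B (act v \<sigma>) (simple_root i)" by simp
  have gW: "g \<in> carrier W" using g by auto
  define t where "t = act (inv v) (simple_root i)"
  \<comment> \<open>The reflection of \<open>\<sigma>\<close> in the wall \<open>t\<close>. As a
    positive combination of two members of \<open>R L\<close>, it lies in \<open>R L\<close>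
    again.\<close>
  define r where "r = (\<lambda>k. \<sigma> k + c * t k)"
  have vt: "act v t = simple_root i" using v act_inv by (simp add: t_def)
  have tR: "t \<in> R L" using refused by (simp add: t_def)
  have \<sigma>R: "\<sigma> \<in> R L" "\<sigma> \<in> roots" and v\<sigma>: "act v \<sigma> \<notin> pos_roots" and u\<sigma>: "act u \<sigma> \<notin> pos_roots"
    using \<sigma> sep by (auto simp: separating_def R_def)
  have "act v r = reflection i (act v \<sigma>)"
    unfolding r_def act_add[OF v] vt by (simp add: reflection_def c(2) fun_eq_iff)
  then have vr: "act v r \<in> roots" "act v r = (\<lambda>k. act v \<sigma> k + c * simple_root i k)"
    using act_roots[of "s i" "act v \<sigma>"] act_roots[OF v \<sigma>R(2)] act_gen[OF i] gen_closed[OF i]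
    unfolding r_def act_add[OF v] vt by auto
  then have rr: "r \<in> roots" using act_roots[of "inv v" "act v r"] act_inv(1)[OF v, of r] v by simp
  have pos: "act h \<beta> \<in> pos_roots" if "h \<in> L" "\<beta> \<in> R L" for h \<beta>
    using that by (auto simp: R_def half_space_def)
  have rR: "r \<in> R L"
  proof -
    have "act h r \<in> pos_roots" if "h \<in> L" for h
      using pos[OF that tR] pos[OF that \<sigma>R(1)] act_roots[of h r] rr c(1) g(2) that act_add[of h \<sigma> c t]
      by (auto simp: pos_roots_iff r_def[symmetric])
    then show ?thesis using rr g(2) by (auto simp: R_def half_space_def)
  qed
  have "act v t \<in> pos_roots"
    unfolding vt using i simple_root_in_roots by (auto simp: pos_roots_iff simple_root_def)
  \<comment> \<open>\<open>t\<close> does not separate \<open>v\<close> from \<open>L\<close>, and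
    \<open>u\<close> and \<open>v\<close> have the same separating roots.\<close>
  then have "act u t \<in> pos_roots" using sep tR by (auto simp: separating_def)
  then have ht: "0 < height (act u t)" "height (act u \<sigma>) < 0"
    using height_pos height_neg act_roots[OF u \<sigma>R(2)] u\<sigma> by auto
  have hg: "0 < height (act g t)" "0 < height (act g \<sigma>)" using height_pos pos g(1) tR \<sigma>R by auto
  have "r \<notin> separating L u"
  proof
    assume "r \<in> separating L u"
    from max[OF this] have "(height (act u \<sigma>) + c * height (act u t)) / (height (act g \<sigma>) + c * height (act g t))
       \<le> height (act u \<sigma>) / height (act g \<sigma>)"
      unfolding r_def act_add[OF u] act_add[OF gW] height_add .
    moreover have "0 < height (act g \<sigma>) + c * height (act g t)" using hg c(1) by (simp add: add_pos_pos)
    ultimately have "(height (act u \<sigma>) + c * height (act u t)) * height (act g \<sigma>)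
       \<le> height (act u \<sigma>) * (height (act g \<sigma>) + c * height (act g t))"
      using hg by (simp add: frac_le_eq divide_le_0_iff pos_divide_le_eq pos_le_divide_eq mult.commute)
    moreover have "height (act u \<sigma>) * (c * height (act g t)) < 0"
      using ht hg c(1) by (simp add: mult_less_0_iff zero_less_mult_iff)
    moreover have "0 < (c * height (act u t)) * height (act g \<sigma>)" using ht hg c(1) by simp
    ultimately show False by (simp add: distrib_left distrib_right)
  qed
  then have vrp: "act v r \<in> pos_roots" using rR sep by (auto simp: separating_def)
  \<comment> \<open>The positive \<open>act v r\<close> and the negative
    \<open>act v \<sigma>\<close> differ only at \<open>i\<close>. So \<open>\<sigma>\<close> is a
    nonpositive multiple of \<open>t\<close>, though both have positive height at
    \<open>g\<close>.\<close>
  have "act v \<sigma> j = 0" if "j \<in> I" "j \<noteq> i" for j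
    using vrp that root_dichotomy[OF act_roots[OF v \<sigma>R(2)] v\<sigma> that(1)]
    unfolding vr(2) by (auto simp: pos_roots_iff simple_root_def)
  then have e: "act v \<sigma> = (\<lambda>k. act v \<sigma> i * simple_root i k)"
    using root_support[OF act_roots[OF v \<sigma>R(2)]] by (auto simp: fun_eq_iff simple_root_def)
  define d where "d = act v \<sigma> i"
  have d: "d \<le> 0" using root_dichotomy[OF act_roots[OF v \<sigma>R(2)] v\<sigma> i] by (simp add: d_def)
  have "\<sigma> = act (inv v) (act v \<sigma>)" using v act_inv by simp
  also have "\<dots> = (\<lambda>k. d * t k)" by (subst e) (simp add: v act_scale d_def t_def)
  finally have "act g \<sigma> = (\<lambda>k. d * act g t k)" using act_scale[OF gW] by simp
  then have "height (act g \<sigma>) = d * height (act g t)" by (simp add: height_def sum_distrib_left)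
  then show False using hg d by (smt (verit) mult_nonpos_nonneg)
qed

text \<open>
  Summing over the period the images of \<open>\<sigma>\<close> just before the \<open>p\<close>-th toggle gives a vector \<open>y p\<close>.
  The \<open>p\<close>-th toggle is the only one to change the coordinate \<open>ks ! p\<close>, so by periodicity the total
  change is zero, and \<open>y p\<close> does not depend on \<open>p\<close>.
\<close>

lemma periodic_point_in_convex:
  assumes fin: "finite (carrier W)" and L: "convex_set L" "L \<noteq> {}" and ks: "is_ordering ks"
    and u: "u \<in> carrier W" and N: "0 < N" "(Pro L ks ^^ N) u = u"
  shows "u \<in> L"
proof (rule ccontr)
  assume nu: "u \<notin> L"
  define n where "n = length ks"
  define U where "U k = (Pro L ks ^^ k) u" for k
  \<comment> \<open>The element in round \<open>k\<close> just before the toggle at position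
    \<open>p\<close>, counted from 0; \<open>p = n\<close> is the start of the next round.\<close>
  define v where "v k p = fold (toggle L) (take p ks) (U k)" for k p
  have ksI: "set ks = I" "distinct ks" using ks by (auto simp: is_ordering_def)
  have takeI: "set (take p ks) \<subseteq> I" "set (drop p ks) \<subseteq> I" for p
    using ksI set_take_subset[of p ks] set_drop_subset[of p ks] by auto
  have nthI: "ks ! p \<in> I" if "p < n" for p using that ksI by (auto simp: n_def)
  have USuc: "U (Suc k) = fold (toggle L) ks (U k)" for k by (simp add: U_def Pro_def)
  have U0: "U 0 = u" "U N = u" using N by (simp_all add: U_def)
  have UW: "U k \<in> carrier W" for k
    by (induction k) (simp_all add: U0 USuc u fold_toggle_closed ksI)
  have vW: "v k p \<in> carrier W" for k p by (simp add: v_def fold_toggle_closed UW takeI)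
  have v0: "v k 0 = U k" "v k n = U (Suc k)" for k by (simp_all add: v_def n_def USuc)
  have sepU: "separating L (U (k + j)) \<subseteq> separating L (U k)" for k j
  proof (induction j)
    case (Suc j)
    then show ?case using separating_fold[OF UW, of ks L "k + j"] USuc ksI by auto
  qed simp
  \<comment> \<open>The decreasing chain of separating sets starts and ends at \<open>u\<close>, so
    it is constant.\<close>
  have sepv: "separating L (v k p) = separating L u" if "k < N" for k p
  proof
    have "separating L (v k p) \<subseteq> separating L (U k)"
      unfolding v_def by (rule separating_fold[OF UW takeI(1)])
    then show "separating L (v k p) \<subseteq> separating L u" using sepU[of 0 k] U0 by auto
    have "U (Suc k) = fold (toggle L) (drop p ks) (v k p)"
      unfolding USuc v_def by (metis append_take_drop_id fold_append comp_apply)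
    then have "separating L (U (Suc k)) \<subseteq> separating L (v k p)"
      using separating_fold[OF vW takeI(2)] by simp
    then show "separating L u \<subseteq> separating L (v k p)"
      using sepU[of "Suc k" "N - Suc k"] that U0 by auto
  qed
  obtain g where g: "g \<in> L" using L(2) by auto
  \<comment> \<open>Denominators are positive on \<open>R L\<close> because \<open>g\<close> lies in
    \<open>L\<close>; numerators are negative on separating roots.\<close>
  define f where "f \<beta> = height (act u \<beta>) / height (act g \<beta>)" for \<beta>
  have "finite (separating L u)"
    using finite_roots[OF fin] by (rule rev_finite_subset) (auto simp: separating_def R_def)
  then have "Max (f ` separating L u) \<in> f ` separating L u"
    "\<And>\<beta>. \<beta> \<in> separating L u \<Longrightarrow> f \<beta> \<le> Max (f ` separating L u)"
    using separating_nonempty[OF L(1) u nu] by auto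
  then obtain \<sigma> where \<sigma>: "\<sigma> \<in> separating L u" "\<And>\<beta>. \<beta> \<in> separating L u \<Longrightarrow> f \<beta> \<le> f \<sigma>"
    by (metis (no_types, lifting) imageE)
  have \<sigma>r: "\<sigma> \<in> roots" using \<sigma>(1) by (simp add: separating_def R_def)
  define x where "x k p = act (v k p) \<sigma>" for k p
  define y where "y p j = (\<Sum>k<N. x k p j)" for p j
  have xr: "x k p \<in> roots" for k p by (simp add: x_def act_roots vW \<sigma>r)
  have xneg: "x k p j \<le> 0" if "k < N" "j \<in> I" for k p j
    using root_dichotomy[OF xr _ that(2)] sepv[OF that(1)] \<sigma>(1) by (auto simp: x_def separating_def)
  define refused where "refused k p \<longleftrightarrow> act (inv (v k p)) (simple_root (ks ! p)) \<in> R L" for k p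
  define d where "d k p = (if refused k p then 0 else - 2 * B (x k p) (simple_root (ks ! p)))" for k p
  define D where "D p = (\<Sum>k<N. d k p)" for p
  have xSuc: "x k (Suc p) j = x k p j + d k p * simple_root (ks ! p) j" if p: "p < n" for k p j
  proof -
    have "v k (Suc p) = toggle L (ks ! p) (v k p)"
      using p by (simp add: v_def take_Suc_conv_app_nth n_def)
    then show ?thesis
      using nthI[OF p] by (simp add: x_def d_def refused_def toggle_def act_mult_apply gen_closed vW
          act_gen reflection_def)
  qed
  have ySuc: "y (Suc p) j = y p j + D p * simple_root (ks ! p) j" if p: "p < n" for p j
    by (simp add: y_def D_def xSuc[OF p] sum.distrib sum_distrib_right)
  have ysum: "y q j = y 0 j + (\<Sum>p<q. D p * simple_root (ks ! p) j)" if "q \<le> n" for q j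
    using that by (induction q) (simp_all add: ySuc)
  \<comment> \<open>One full round shifts the summation index by one, and the end terms agree since
    \<open>U N = u\<close>.\<close>
  have yn: "y n j = y 0 j" for j
  proof -
    have "y n j = (\<Sum>k<N. x (Suc k) 0 j)" by (simp add: y_def x_def v0)
    also have "\<dots> = (\<Sum>k<Suc N. x k 0 j) - x 0 0 j" by (subst sum.lessThan_Suc_shift) simp
    also have "\<dots> = y 0 j" by (simp add: y_def x_def v0 U0)
    finally show ?thesis .
  qed
  have D0: "D p = 0" if p: "p < n" for p
  proof -
    have "(\<Sum>p'<n. D p' * simple_root (ks ! p') (ks ! p)) = (\<Sum>p'<n. if p' = p then D p' else 0)"
      using p ksI(2) by (intro sum.cong HOL.refl) (auto simp: simple_root_def n_def nth_eq_iff_index_eq)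
    then show ?thesis using ysum[of n "ks ! p"] yn p by simp
  qed
  have yconst: "y p = y 0" if "p \<le> n" for p
    using ysum[OF that] D0 that by (auto simp: fun_eq_iff)
  have dominant: "0 \<le> ip (y 0) (simple_root i)" if i: "i \<in> I" for i
  proof -
    obtain p where p: "p < n" "ks ! p = i" using i ksI(1) by (auto simp: in_set_conv_nth n_def)
    define a where "a = ip (simple_root i) (simple_root i)"
    \<comment> \<open>If the toggle moves, \<open>ip_simple\<close> makes this expression 0; if it
      is refused, the correction \<open>d k p\<close> is 0. The corrections sum to a multiple of
      \<open>D p\<close>, which vanishes.\<close>
    have "0 \<le> ip (x k p) (simple_root i) + a / 2 * d k p" if k: "k < N" for k
    proof (cases "refused k p")
      case True
      then have "0 \<le> ip (x k p) (simple_root i)"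
        unfolding x_def using refused_toggle_ip_nonneg[OF fin u vW sepv[OF k] g convex_set_carrier[OF L(1)] \<sigma>(1) _ i]
          \<sigma>(2) p(2) by (simp add: f_def refused_def)
      then show ?thesis using True by (simp add: d_def)
    next
      case False
      then show ?thesis using ip_simple[OF i, of "x k p"] p(2) by (simp add: d_def a_def)
    qed
    then have "0 \<le> (\<Sum>k<N. ip (x k p) (simple_root i) + a / 2 * d k p)" by (intro sum_nonneg) auto
    also have "\<dots> = ip (y p) (simple_root i) + a / 2 * D p"
      unfolding y_def D_def by (simp add: sum.distrib sum_distrib_left ip_sum)
    finally show ?thesis using D0[OF p(1)] yconst[of p] p(1) by simp
  qed
  have yneg: "y 0 j \<le> 0" if "j \<in> I" for j
    unfolding y_def using xneg that by (intro sum_nonpos) auto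
  \<comment> \<open>Expanding one argument in simple roots pairs nonpositive coordinates with
    nonnegative products.\<close>
  have "y 0 = (\<lambda>k. \<Sum>i\<in>I. y 0 i * simple_root i k)"
  proof
    fix k
    show "y 0 k = (\<Sum>i\<in>I. y 0 i * simple_root i k)"
      using finite_index root_support[OF xr, of k]
      by (cases "k \<in> I") (simp_all add: simple_root_def y_def if_distrib[of "\<lambda>x. _ * x"] sum.delta' cong: if_cong)
  qed
  then have "ip (y 0) (y 0) = ip (\<lambda>k. \<Sum>i\<in>I. y 0 i * simple_root i k) (y 0)" by (rule arg_cong)
  also have "\<dots> = (\<Sum>i\<in>I. y 0 i * ip (y 0) (simple_root i))"
    using ip_comb[of "y 0 _" "simple_root _" 0 "\<lambda>_. 0" "y 0"]
    by (simp add: ip_sum[OF finite_index] ip_sym[of "y 0" "simple_root _"])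
  also have "\<dots> \<le> 0" using yneg dominant by (intro sum_nonpos mult_nonpos_nonneg) auto
  finally have y0: "y 0 j = 0" if "j \<in> I" for j using ip_definite[OF fin _ that] by simp
  \<comment> \<open>The vanishing sum has only nonpositive terms, but a root has a nonzero
    coordinate.\<close>
  obtain j where j: "j \<in> I" "x 0 0 j \<noteq> 0" using root_nonzero[OF xr] by blast
  have "- x 0 0 j \<le> (\<Sum>k<N. - x k 0 j)"
    using N(1) xneg j(1) by (intro member_le_sum) auto
  then have "0 \<le> x 0 0 j" using y0[OF j(1)] by (simp add: y_def sum_negf)
  then show False using xneg[of 0 j 0] j N(1) by simp
qed

text \<open>By finiteness every orbit of \<open>Pro\<close> repeats a point; that point is periodic,
  hence in \<open>L\<close>.\<close>

lemma finite_superfuturistic: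
  assumes fin: "finite (carrier W)" shows superfuturistic
  unfolding superfuturistic_def superheavy_def
proof (intro allI impI ballI, elim conjE)
  fix L c ks u
  assume L: "L \<noteq> {}" "convex_set L" and ks: "is_ordering ks" and u: "u \<in> carrier W"
  define U where "U k = (Pro L ks ^^ k) u" for k
  have UW: "U k \<in> carrier W" for k
    using ks u by (induction k) (simp_all add: U_def Pro_def fold_toggle_closed is_ordering_def)
  have "\<not> inj U"
    using UW fin finite_subset[of "range U" "carrier W"] finite_imageD[of U UNIV] by auto
  then obtain a b where ab: "a < b" "U a = U b" by (metis injI linorder_neqE_nat)
  have "U b = (Pro L ks ^^ (b - a)) (U a)"
    unfolding U_def using ab(1) funpow_add[of "b - a" a "Pro L ks"] by simp
  then have "U a \<in> L"
    using periodic_point_in_convex[OF fin L(2,1) ks UW, of "b - a"] ab by simp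
  then show "\<exists>K. (Pro L ks ^^ K) u \<in> L" by (auto simp: U_def)
qed

end

theorem theorem1p14:
  fixes W :: "('a, 'b) monoid_scheme" and I :: "'i set" and s :: "'i \<Rightarrow> 'a"
  assumes "coxeter_system W I s"
    and "finite (carrier W)"
  shows "coxeter_system.superfuturistic W I s"
  using coxeter_system.finite_superfuturistic[OF assms] .

end
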